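(* Let $P$ be a finite normal logic program, let $\mathcal{A}_P$ be the set of atoms occurring in $P$, and let $S\subseteq\mathcal{A}_P$. Then $S$ is a stable model of $P$ if and only if $S$ is the final true set $T^\infty$ of some successful DProp computation for $P$ on the atom set $\mathcal{A}=\mathcal{A}_P$.
   Context: Programs. A rule $r$ of a (propositional) normal logic program has the form $a\leftarrow b_1,\dots,b_m,\mathit{not}\,c_1,\dots,\mathit{not}\,c_l$ with $m,l\ge 0$ and $a,b_i,c_j$ atoms; $H(r)=a$, $B^+(r)=\{b_1,\dots,b_m\}$, $B^-(r)=\{c_1,\dots,c_l\}$. A program is a set of rules over a set of atoms $\mathcal{A}$. An interpretation is a subset $I\subseteq\mathcal{A}$; it is a model of $P$ if for each $r\in P$, $B^+(r)\subseteq I$ and $B^-(r)\cap I=\emptyset$ imply $H(r)\in I$. The reduct $P^I$ is obtained from $P$ by deleting every rule $r$ with $B^-(r)\cap I\ne\emptyset$ and removing all negative literals from the remaining rules. $I$ is a stable model of $P$ if it is the least model of $P^I$. Consequence operator. For $I,J\subseteq\mathcal{A}$, $C_{P,J}(I)=\{H(r)\mid r\in P,\ B^+(r)\subseteq I,\ B^-(r)\cap J=\emptyset\}$; $C_{P,J}^0(I)=I$, $C_{P,J}^{k+1}(I)=C_{P,J}(C_{P,J}^k(I))$; $C_{P,J}^\infty(I)$ is the fixpoint at which the sequence $(C_{P,J}^k(I))_k$ stabilizes (in particular $C_{P,J}^\infty(\emptyset)$ is the least fixpoint of $C_{P,J}$). DProp. A DProp run for $P$ on $\mathcal{A}$ starts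 with $T^0=C_{P,\mathcal{A}}^\infty(\emptyset)$, $F^0=\emptyset$, $U^0=\mathcal{A}\setminus(T^0\cup F^0)$. If the current undecided set is empty, the run terminates. Otherwise iteration $k\ge1$ consists of: (Decision) choose, arbitrarily, an atom $a\in U^{k-1}$ and set $F^k=F^{k-1}\cup\{a\}$; (Propagation) set $T^k=C_{P,\mathcal{A}\setminus F^k}^\infty(T^{k-1})$ and $U^k=U^{k-1}\setminus(T^k\cup F^k)$; (Termination) if $U^k=\emptyset$, stop and return $T^k$; otherwise go to iteration $k+1$. When the run terminates, the final sets are denoted $T^\infty,F^\infty,U^\infty$. A successful DProp computation is a DProp run that terminates with $U^\infty=\emptyset$ and $T^\infty\cap F^\infty=\emptyset$. *)

theory Defs
  imports Main "HOL-Library.FSet"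
begin

datatype 'a rule = Rule (head: 'a) (pos_body: "'a fset") (neg_body: "'a fset")

type_synonym 'a prog = "'a rule set"

definition atoms :: "'a prog \<Rightarrow> 'a set" where
  "atoms P = (\<Union>r\<in>P. {head r} \<union> fset (pos_body r) \<union> fset (neg_body r))"

text \<open>The underlying atom set \<open>A\<close> is an explicit parameter: interpretations are the subsets of \<open>A\<close>.\<close>

definition model :: "'a set \<Rightarrow> 'a prog \<Rightarrow> 'a set \<Rightarrow> bool" where
  "model A P I \<longleftrightarrow> I \<subseteq> A \<and>
     (\<forall>r\<in>P. fset (pos_body r) \<subseteq> I \<longrightarrow> fset (neg_body r) \<inter> I = {} \<longrightarrow> head r \<in> I)"

definition least_model :: "'a set \<Rightarrow> 'a prog \<Rightarrow> 'a set \<Rightarrow> bool" where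
  "least_model A P I \<longleftrightarrow> model A P I \<and> (\<forall>J. model A P J \<longrightarrow> I \<subseteq> J)"

definition reduct :: "'a prog \<Rightarrow> 'a set \<Rightarrow> 'a prog" where
  "reduct P I = {Rule (head r) (pos_body r) {||} | r. r \<in> P \<and> fset (neg_body r) \<inter> I = {}}"

definition stable_model :: "'a set \<Rightarrow> 'a prog \<Rightarrow> 'a set \<Rightarrow> bool" where
  "stable_model A P I \<longleftrightarrow> least_model A (reduct P I) I"

definition cons_op :: "'a prog \<Rightarrow> 'a set \<Rightarrow> 'a set \<Rightarrow> 'a set" where
  "cons_op P J I = {head r | r. r \<in> P \<and> fset (pos_body r) \<subseteq> I \<and> fset (neg_body r) \<inter> J = {}}"

text \<open>
  The value at which the iterates of \<open>cons_op P J\<close> from \<open>I\<close> become constant. It is unspecified if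
  they never do. For finite \<open>P\<close> they do whenever \<open>I \<subseteq> cons_op P J I\<close>, because the iterates are
  then increasing, and every use in a DProp run satisfies this inclusion.
\<close>

definition cons_limit :: "'a prog \<Rightarrow> 'a set \<Rightarrow> 'a set \<Rightarrow> 'a set" where
  "cons_limit P J I = (THE X. \<exists>n. \<forall>k\<ge>n. (cons_op P J ^^ k) I = X)"

text \<open>
  A run with \<open>n\<close> iterations; only the entries \<open>T k\<close>, \<open>F k\<close>, \<open>U k\<close> with \<open>k \<le> n\<close> matter.
  The decision \<open>a \<in> U k\<close> forces \<open>U k \<noteq> {}\<close>, so no iteration follows one at which the run stops.
\<close>

definition dprop_run ::
  "'a prog \<Rightarrow> 'a set \<Rightarrow> nat \<Rightarrow> (nat \<Rightarrow> 'a set) \<Rightarrow> (nat \<Rightarrow> 'a set) \<Rightarrow> (nat \<Rightarrow> 'a set) \<Rightarrow> bool" where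
  "dprop_run P A n T F U \<longleftrightarrow>
     T 0 = cons_limit P A {} \<and> F 0 = {} \<and> U 0 = A - (T 0 \<union> F 0) \<and>
     (\<forall>k<n. \<exists>a\<in>U k.
        F (Suc k) = F k \<union> {a} \<and>
        T (Suc k) = cons_limit P (A - F (Suc k)) (T k) \<and>
        U (Suc k) = U k - (T (Suc k) \<union> F (Suc k)))"

definition successful_dprop ::
  "'a prog \<Rightarrow> 'a set \<Rightarrow> nat \<Rightarrow> (nat \<Rightarrow> 'a set) \<Rightarrow> (nat \<Rightarrow> 'a set) \<Rightarrow> (nat \<Rightarrow> 'a set) \<Rightarrow> bool" where
  "successful_dprop P A n T F U \<longleftrightarrow> dprop_run P A n T F U \<and> U n = {} \<and> T n \<inter> F n = {}"

end

(* In any run, T k is the least fixpoint of cons_op P (A - F k), and U k = A - (T k \<union> F k). A set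
   S \<subseteq> A is stable iff it is the least fixpoint of cons_op P S. If a run succeeds, then T n and F n
   partition A, so A - F n = T n and T n is stable. Conversely, given a stable S, decide only on atoms
   outside S. Then F k is disjoint from S, so T k \<subseteq> S by antitonicity; and if all undecided atoms
   were in S, then A - F k = S, whence T k = S and nothing is undecided. As F k grows, this run
   stops, and there T n = S. *)
theory Submission
  imports Defs
begin

lemma mono_cons_op: "mono (cons_op P J)"
  unfolding cons_op_def by (rule monoI) blast

lemma cons_op_antimono: "J' \<subseteq> J \<Longrightarrow> cons_op P J I \<subseteq> cons_op P J' I"
  unfolding cons_op_def by blast

lemma lfp_cons_op_antimono: "J' \<subseteq> J \<Longrightarrow> lfp (cons_op P J) \<subseteq> lfp (cons_op P J')"
  by (rule lfp_mono) (rule cons_op_antimono)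

lemma cons_op_subset_atoms: "cons_op P J I \<subseteq> atoms P"
  unfolding cons_op_def atoms_def by blast

lemma lfp_cons_op_subset_atoms: "lfp (cons_op P J) \<subseteq> atoms P"
  by (rule lfp_lowerbound) (rule cons_op_subset_atoms)

lemma finite_atoms: "finite P \<Longrightarrow> finite (atoms P)"
  unfolding atoms_def by simp

text \<open>The iterates increase from \<open>x\<close> and take finitely many values, so two
  coincide; monotonicity then yields a pre-fixpoint, while \<open>x \<le> lfp f\<close> keeps every
  iterate below \<open>lfp f\<close>.\<close>

lemma funpow_eventually_lfp:
  fixes f :: "'a::complete_lattice \<Rightarrow> 'a"
  assumes "mono f" "finite (range f)" "x \<le> f x" "x \<le> lfp f"
  shows "\<exists>n. \<forall>k\<ge>n. (f ^^ k) x = lfp f"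
proof -
  let ?g = "\<lambda>n. (f ^^ n) x"
  have step: "?g n \<le> ?g (Suc n)" for n
    using assms(1,3) by (induction n) (auto dest: monoD)
  have le: "?g i \<le> ?g j" if "i \<le> j" for i j
    using lift_Suc_mono_le[of ?g] step that by blast
  have bound: "?g n \<le> lfp f" for n
  proof (induction n)
    case (Suc n)
    then show ?case using monoD[OF assms(1) Suc] lfp_unfold[OF assms(1)] by simp
  qed (use assms(4) in simp)
  \<comment> \<open>The zeroth iterate is \<open>x\<close> itself, which may lie outside
    \<open>range f\<close>.\<close>
  have "range ?g \<subseteq> insert x (range f)"
  proof clarify
    fix n assume "(f ^^ n) x \<notin> range f"
    then show "(f ^^ n) x = x" by (cases n) auto
  qed
  then have "finite (range ?g)" using assms(2) finite_subset by blast
  then have "\<not> inj ?g" using finite_imageD infinite_UNIV_nat by blast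
  then obtain i j where "i < j" "?g i = ?g j"
    unfolding inj_def by (metis nat_neq_iff)
  \<comment> \<open>Since \<open>Suc i \<le> j\<close>, the repeated value squeezes the next
    iterate: \<open>?g i\<close> is a pre-fixpoint and hence above \<open>lfp f\<close>.\<close>
  then have "?g (Suc i) \<le> ?g i" using le[of "Suc i" j] by simp
  then have "lfp f \<le> ?g i" by (intro lfp_lowerbound) simp
  then have "?g k = lfp f" if "i \<le> k" for k
    using le[OF that] bound[of k] by (meson antisym order_trans)
  then show ?thesis by blast
qed

lemma cons_limit_eq_lfp:
  assumes "finite P" "I \<subseteq> cons_op P J I" "I \<subseteq> lfp (cons_op P J)"
  shows "cons_limit P J I = lfp (cons_op P J)"
proof -
  have "range (cons_op P J) \<subseteq> Pow (atoms P)"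
    by (simp add: image_subset_iff cons_op_subset_atoms)
  then have "finite (range (cons_op P J))"
    using finite_atoms[OF assms(1)] finite_subset by blast
  from funpow_eventually_lfp[OF mono_cons_op this assms(2,3)]
  have ev: "\<exists>n. \<forall>k\<ge>n. (cons_op P J ^^ k) I = lfp (cons_op P J)" .
  show ?thesis
    unfolding cons_limit_def
  proof (rule the_equality[where P = "\<lambda>X. \<exists>n. \<forall>k\<ge>n. (cons_op P J ^^ k) I = X", OF ev])
    fix X assume "\<exists>n. \<forall>k\<ge>n. (cons_op P J ^^ k) I = X"
    with ev show "X = lfp (cons_op P J)" by (metis nat_le_linear)
  qed
qed

lemma cons_limit_empty: "finite P \<Longrightarrow> cons_limit P J {} = lfp (cons_op P J)"
  by (rule cons_limit_eq_lfp) auto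

text \<open>Propagation restarts from the previous true set rather than from the empty set.
  Shrinking \<open>J\<close> only enables more rules, so the old least fixpoint is still a valid
  increasing start below the new one.\<close>

lemma cons_limit_lfp:
  assumes "finite P" "J' \<subseteq> J"
  shows "cons_limit P J' (lfp (cons_op P J)) = lfp (cons_op P J')"
proof (rule cons_limit_eq_lfp[OF assms(1) _ lfp_cons_op_antimono[OF assms(2)]])
  show "lfp (cons_op P J) \<subseteq> cons_op P J' (lfp (cons_op P J))"
    by (subst lfp_unfold[OF mono_cons_op]) (rule cons_op_antimono[OF assms(2)])
qed

text \<open>Rules of the reduct have empty negative bodies, so its models are the pre-fixpoints of
  the operator with \<open>S\<close> held fixed.\<close>

lemma model_reduct_iff: "model A (reduct P S) I \<longleftrightarrow> I \<subseteq> A \<and> cons_op P S I \<subseteq> I"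
proof -
  have "(\<forall>r\<in>reduct P S. Q r) \<longleftrightarrow>
      (\<forall>r\<in>P. fset (neg_body r) \<inter> S = {} \<longrightarrow> Q (Rule (head r) (pos_body r) {||}))" for Q
    unfolding reduct_def by blast
  then have "model A (reduct P S) I \<longleftrightarrow> I \<subseteq> A \<and>
      (\<forall>r\<in>P. fset (neg_body r) \<inter> S = {} \<longrightarrow> fset (pos_body r) \<subseteq> I \<longrightarrow> head r \<in> I)"
    by (simp add: model_def)
  also have "\<dots> \<longleftrightarrow> I \<subseteq> A \<and> cons_op P S I \<subseteq> I"
    unfolding cons_op_def by blast
  finally show ?thesis .
qed

text \<open>By Knaster-Tarski the least pre-fixpoint is \<open>lfp\<close>, and it stays inside
  \<open>atoms P\<close>, so it is the least model of the reduct.\<close>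

lemma stable_model_iff_lfp:
  "stable_model (atoms P) P S \<longleftrightarrow> S = lfp (cons_op P S)"
proof -
  let ?L = "lfp (cons_op P S)"
  have model: "model (atoms P) (reduct P S) ?L"
    using lfp_cons_op_subset_atoms lfp_unfold[OF mono_cons_op] by (fastforce simp: model_reduct_iff)
  have "?L \<subseteq> I" if "model (atoms P) (reduct P S) I" for I
    using that by (simp add: model_reduct_iff lfp_lowerbound)
  then show ?thesis
    using model unfolding stable_model_def least_model_def by (metis subset_antisym)
qed

text \<open>Replaces the recursion for \<open>T\<close> and \<open>U\<close> by closed forms in
  \<open>F\<close>, so that a run is determined by its decisions alone.\<close>

lemma dprop_run_iff:
  assumes "finite P"
  shows "dprop_run P A n T F U \<longleftrightarrow>
    F 0 = {} \<and> (\<forall>k<n. \<exists>a\<in>U k. F (Suc k) = insert a (F k)) \<and>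
    (\<forall>k\<le>n. T k = lfp (cons_op P (A - F k)) \<and> U k = A - (T k \<union> F k))"
proof (induction n)
  case 0
  show ?case
    unfolding dprop_run_def cons_limit_empty[OF assms] by (simp cong: conj_cong) (rule conj_left_commute)
next
  case (Suc n)
  have run_Suc: "dprop_run P A (Suc n) T F U \<longleftrightarrow> dprop_run P A n T F U \<and>
      (\<exists>a\<in>U n. F (Suc n) = F n \<union> {a} \<and>
        T (Suc n) = cons_limit P (A - F (Suc n)) (T n) \<and>
        U (Suc n) = U n - (T (Suc n) \<union> F (Suc n)))"
    unfolding dprop_run_def by (simp only: All_less_Suc conj_ac)
  have step: "cons_limit P (A - F (Suc n)) (T n) = lfp (cons_op P (A - F (Suc n)))"
    "T n \<subseteq> lfp (cons_op P (A - F (Suc n)))"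
    if "T n = lfp (cons_op P (A - F n))" "F (Suc n) = insert a (F n)" for a
  proof -
    have sub: "A - F (Suc n) \<subseteq> A - F n" using that(2) by blast
    show "cons_limit P (A - F (Suc n)) (T n) = lfp (cons_op P (A - F (Suc n)))"
      unfolding that(1) by (rule cons_limit_lfp[OF assms sub])
    show "T n \<subseteq> lfp (cons_op P (A - F (Suc n)))"
      unfolding that(1) by (rule lfp_cons_op_antimono[OF sub])
  qed
  \<comment> \<open>The incremental update of \<open>U\<close> agrees with the closed form because
    \<open>T\<close> and \<open>F\<close> only grow: atoms removed earlier remain excluded.\<close>
  have last: "T (Suc n) = cons_limit P (A - F (Suc n)) (T n) \<and>
        U (Suc n) = U n - (T (Suc n) \<union> F (Suc n)) \<longleftrightarrow>
      T (Suc n) = lfp (cons_op P (A - F (Suc n))) \<and> U (Suc n) = A - (T (Suc n) \<union> F (Suc n))"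
    if "T n = lfp (cons_op P (A - F n))" "U n = A - (T n \<union> F n)" "F (Suc n) = insert a (F n)" for a
  proof -
    have "U n - (T (Suc n) \<union> F (Suc n)) = A - (T (Suc n) \<union> F (Suc n))"
      if "T (Suc n) = lfp (cons_op P (A - F (Suc n)))"
      using step(2)[OF \<open>T n = _\<close> \<open>F (Suc n) = _\<close>, folded that] \<open>U n = _\<close> \<open>F (Suc n) = _\<close> by blast
    then show ?thesis
      unfolding step(1)[OF that(1,3)] by (intro conj_cong refl) simp
  qed
  \<comment> \<open>With decisions and closed forms made opaque, only reindexing remains:
    \<open>D\<close> ranges over \<open>k < n\<close>, \<open>G\<close> over
    \<open>k \<le> n\<close>.\<close>
  define D where "D k \<longleftrightarrow> (\<exists>a\<in>U k. F (Suc k) = insert a (F k))" for k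
  define G where "G k \<longleftrightarrow> T k = lfp (cons_op P (A - F k)) \<and> U k = A - (T k \<union> F k)" for k
  have "(\<exists>a\<in>U n. F (Suc n) = F n \<union> {a} \<and>
      T (Suc n) = cons_limit P (A - F (Suc n)) (T n) \<and>
      U (Suc n) = U n - (T (Suc n) \<union> F (Suc n))) \<longleftrightarrow> D n \<and> G (Suc n)" if "G n"
  proof -
    have "T n = lfp (cons_op P (A - F n))" "U n = A - (T n \<union> F n)"
      using that by (simp_all add: G_def)
    note eq = last[OF this, folded G_def]
    show ?thesis
    proof (cases "D n")
      case True
      then obtain a where "F (Suc n) = insert a (F n)" unfolding D_def by blast
      from eq[OF this] show ?thesis unfolding D_def by simp
    next
      case False
      then show ?thesis unfolding D_def by simp
    qed
  qed
  then show ?case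
    unfolding run_Suc Suc.IH D_def[symmetric] G_def[symmetric]
    by (auto simp: less_Suc_eq le_Suc_eq)
qed

lemma successful_dprop_stable:
  assumes "finite P" "successful_dprop P (atoms P) n T F U"
  shows "stable_model (atoms P) P (T n)"
proof -
  from assms(2) have run: "dprop_run P (atoms P) n T F U"
    and fin: "U n = {}" "T n \<inter> F n = {}"
    by (auto simp: successful_dprop_def)
  from run have T: "T n = lfp (cons_op P (atoms P - F n))"
    and U: "U n = atoms P - (T n \<union> F n)"
    unfolding dprop_run_iff[OF assms(1)] by auto
  have "T n \<subseteq> atoms P" unfolding T by (rule lfp_cons_op_subset_atoms)
  with U fin have "atoms P - F n = T n" by blast
  then show ?thesis using T unfolding stable_model_iff_lfp by (rule subst)
qed

lemma stable_successful_dprop: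
  assumes "finite P" "stable_model (atoms P) P S"
  shows "\<exists>n T F U. successful_dprop P (atoms P) n T F U \<and> S = T n"
proof -
  \<comment> \<open>\<open>L X\<close> and \<open>R X\<close> are the true and undecided sets
    belonging to a false set \<open>X\<close>.\<close>
  define L where "L X = lfp (cons_op P (atoms P - X))" for X
  define R where "R X = atoms P - (L X \<union> X)" for X
  \<comment> \<open>The choice is meaningful only while \<open>R X - S\<close> is nonempty; later
    values are arbitrary and lie beyond the end of the run.\<close>
  define F where "F k = ((\<lambda>X. insert (SOME a. a \<in> R X - S) X) ^^ k) {}" for k
  have F0: "F 0 = {}" and FSuc: "F (Suc k) = insert (SOME a. a \<in> R (F k) - S) (F k)" for k
    by (simp_all add: F_def)
  have S: "S = lfp (cons_op P S)" using assms(2) unfolding stable_model_iff_lfp .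
  have SA: "S \<subseteq> atoms P" by (subst S) (rule lfp_cons_op_subset_atoms)
  have L_sub: "L X \<subseteq> S" if "X \<inter> S = {}" for X
  proof -
    have "S \<subseteq> atoms P - X" using SA that by blast
    then show ?thesis unfolding L_def by (subst S) (rule lfp_cons_op_antimono)
  qed
  have ex: "R X - S \<noteq> {}" if "X \<inter> S = {}" "R X \<noteq> {}" for X
  proof
    assume "R X - S = {}"
    then have eq: "atoms P - X = S" using L_sub[OF that(1)] SA that(1) by (auto simp: R_def)
    have "L X = S" unfolding L_def eq by (rule S[symmetric])
    with eq show False using that(2) by (auto simp: R_def)
  qed
  have some: "(SOME a. a \<in> R X - S) \<in> R X - S" if "X \<inter> S = {}" "R X \<noteq> {}" for X
    by (rule someI_ex) (use ex[OF that] in blast)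
  \<comment> \<open>Each chosen atom is undecided and hence new, so the cardinality counts the
    decisions; finiteness of \<open>atoms P\<close> then bounds them.\<close>
  have inv: "F k \<inter> S = {} \<and> F k \<subseteq> atoms P \<and> card (F k) = k" if "\<forall>j<k. R (F j) \<noteq> {}" for k
    using that
  proof (induction k)
    case 0
    then show ?case by (simp add: F0)
  next
    case (Suc k)
    then have IH: "F k \<inter> S = {}" "F k \<subseteq> atoms P" "card (F k) = k" by auto
    have "(SOME a. a \<in> R (F k) - S) \<in> R (F k) - S"
      using some[OF IH(1)] Suc.prems by blast
    then show ?case
      using IH finite_subset[OF IH(2) finite_atoms[OF assms(1)]] by (auto simp: FSuc R_def)
  qed
  have "\<exists>k. R (F k) = {}"
  proof (rule ccontr)
    assume "\<nexists>k. R (F k) = {}"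
    then have "card (F k) = k" "F k \<subseteq> atoms P" for k using inv[of k] by auto
    then have "k \<le> card (atoms P)" for k
      using card_mono[OF finite_atoms[OF assms(1)]] by metis
    from this[of "Suc (card (atoms P))"] show False by simp
  qed
  \<comment> \<open>Minimality of \<open>n\<close> makes every earlier choice a genuine
    decision.\<close>
  then obtain n where n: "R (F n) = {}" "\<forall>j<n. R (F j) \<noteq> {}"
    using exists_least_iff[of "\<lambda>k. R (F k) = {}"] by auto
  have FS: "F k \<inter> S = {}" if "k \<le> n" for k using inv[of k] n(2) that by auto
  have "dprop_run P (atoms P) n (\<lambda>k. L (F k)) F (\<lambda>k. R (F k))"
    unfolding dprop_run_iff[OF assms(1)]
  proof (intro conjI allI impI)
    fix k assume "k < n"
    then have "(SOME a. a \<in> R (F k) - S) \<in> R (F k) - S"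
      using some[OF FS[of k]] n(2) by simp
    then show "\<exists>a\<in>R (F k). F (Suc k) = insert a (F k)"
      using FSuc by blast
  qed (simp_all add: F0 L_def R_def)
  \<comment> \<open>With nothing undecided, an atom of \<open>S\<close> lies in
    \<open>L (F n)\<close> or \<open>F n\<close>, and the latter is disjoint from
    \<open>S\<close>.\<close>
  moreover have "L (F n) = S" "L (F n) \<inter> F n = {}"
    using L_sub[OF FS] FS[of n] n(1) SA by (auto simp: R_def)
  ultimately show ?thesis using n(1) unfolding successful_dprop_def by metis
qed

theorem theorem1:
  fixes P :: "'a prog" and S :: "'a set"
  assumes "finite P" and "S \<subseteq> atoms P"
  shows "stable_model (atoms P) P S \<longleftrightarrow>
    (\<exists>n T F U. successful_dprop P (atoms P) n T F U \<and> S = T n)"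
proof
  assume "stable_model (atoms P) P S"
  then show "\<exists>n T F U. successful_dprop P (atoms P) n T F U \<and> S = T n"
    by (rule stable_successful_dprop[OF assms(1)])
next
  assume "\<exists>n T F U. successful_dprop P (atoms P) n T F U \<and> S = T n"
  then show "stable_model (atoms P) P S"
    by (elim exE conjE) (simp add: successful_dprop_stable[OF assms(1)])
qed

end
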